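(* Let $G$ be a countable group which has an infinite weakly amenable subgroup, and let $S=2$ or $S=\omega$. Then for every reasonable pointclass $\boldsymbol{\Gamma}$, $(\boldsymbol{\Gamma},E_G)$-determinacy implies $\boldsymbol{\Gamma}$-determinacy.
   Context: A pointclass is a collection of subsets of Polish spaces closed under continuous preimages. A pointclass $\boldsymbol{\Gamma}$ is reasonable if it is closed under unions and intersections with $\boldsymbol{\Delta}^0_6$ sets and closed under substitutions by $\boldsymbol{\Delta}^0_6$-measurable functions. The shift action of $G$ on $S^G$ is $(g\cdot x)(h)=x(g^{-1}h)$, with orbit equivalence relation $E_G$. An enumeration $\pi:\omega\to G$ (a bijection) induces a homeomorphism $\pi:S^\omega\to S^G$, $\pi(x)(\pi(n))=x(n)$. $(\boldsymbol{\Gamma},E_G)$-determinacy means: for every $E_G$-invariant $A\subseteq S^G$ in $\boldsymbol{\Gamma}$ and every enumeration $\pi$, $\pi^{-1}(A)\subseteq S^\omega$ is determined (Gale–Stewart game with moves in $S$). $\boldsymbol{\Gamma}$-determinacy means every set in $\boldsymbol{\Gamma}$ (a subset of $S^\omega$) is determined. A countable group $H$ is weakly amenable if either $H$ is finite, or there is an equivalence relation $\sim$ on $H$ such that (1) $H/\!\sim$ is infinite, (2) for every $h\in H$ there is $b(h)\in\mathbb{N}$ such that for every class $C$, at most $b(h)$ classes $C'$ satisfy $hC\cap C'\neq\emptyset$; and there is an increasing sequence of finite sets $A_n\subseteq H/\!\sim$ with union $H/\!\sim$ such that for every $h\in H$, $\lim_{n\to\infty}|\{C\in A_n: hC\subseteq\bigcup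 A_n\}|/|A_n|=1$. *)

theory Defs
  imports "HOL-Analysis.Analysis" "HOL-Algebra.Coset"
begin

section \<open>Polish spaces and the finite Borel hierarchy\<close>

definition Polish_space :: "'a topology \<Rightarrow> bool" where
  "Polish_space X \<longleftrightarrow> completely_metrizable_space X \<and> separable_space X"

text \<open>Only the finite levels \<open>n \<ge> 1\<close> are inhabited. In the second rule the sets
  \<open>topspace X - C i\<close> are the \<open>\<Pi>\<^sup>0\<close>-sets of lower level whose union is formed.\<close>

inductive Sigma0 :: "'a topology \<Rightarrow> nat \<Rightarrow> 'a set \<Rightarrow> bool" for X :: "'a topology" where
  Sigma0_open: "openin X U \<Longrightarrow> Sigma0 X 1 U"
| Sigma0_Union: "\<lbrakk>1 < n; \<And>i::nat. m i < n; \<And>i. Sigma0 X (m i) (C i)\<rbrakk>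
    \<Longrightarrow> Sigma0 X n (\<Union>i. topspace X - C i)"

definition Pi0 :: "'a topology \<Rightarrow> nat \<Rightarrow> 'a set \<Rightarrow> bool" where
  "Pi0 X n A \<longleftrightarrow> A \<subseteq> topspace X \<and> Sigma0 X n (topspace X - A)"

definition Delta0 :: "'a topology \<Rightarrow> nat \<Rightarrow> 'a set \<Rightarrow> bool" where
  "Delta0 X n A \<longleftrightarrow> Sigma0 X n A \<and> Pi0 X n A"

definition Delta0_measurable ::
    "nat \<Rightarrow> 'a topology \<Rightarrow> 'b topology \<Rightarrow> ('a \<Rightarrow> 'b) \<Rightarrow> bool" where
  "Delta0_measurable n X Y f \<longleftrightarrow>
     f \<in> topspace X \<rightarrow> topspace Y \<and>
     (\<forall>U. openin Y U \<longrightarrow> Delta0 X n {x \<in> topspace X. f x \<in> U})"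

section \<open>Pointclasses\<close>

text \<open>HOL cannot quantify over spaces of all types at once. Since a Polish space has at most
  continuum many points, every one has a homeomorphic copy whose points are elements of
  \<^typ>\<open>nat \<Rightarrow> nat\<close> (lemma \<open>Polish_space_copy\<close>), so a pointclass is
  given by the sets it contains in the Polish topologies with arbitrary carrier in that type:
  \<open>\<Gamma> X\<close> is the collection of the subsets of \<open>X\<close> belonging to \<open>\<Gamma>\<close>.\<close>

type_synonym pointclass = "(nat \<Rightarrow> nat) topology \<Rightarrow> (nat \<Rightarrow> nat) set set"

definition is_pointclass :: "pointclass \<Rightarrow> bool" where
  "is_pointclass \<Gamma> \<longleftrightarrow>
     (\<forall>X A. A \<in> \<Gamma> X \<longrightarrow> Polish_space X \<and> A \<subseteq> topspace X) \<and>
     (\<forall>X Y f A. Polish_space X \<longrightarrow> Polish_space Y \<longrightarrow> continuous_map X Y f \<longrightarrow> A \<in> \<Gamma> Y \<longrightarrow>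
        {x \<in> topspace X. f x \<in> A} \<in> \<Gamma> X)"

definition reasonable :: "pointclass \<Rightarrow> bool" where
  "reasonable \<Gamma> \<longleftrightarrow> is_pointclass \<Gamma> \<and>
     (\<forall>X A D. A \<in> \<Gamma> X \<longrightarrow> Delta0 X 6 D \<longrightarrow> A \<union> D \<in> \<Gamma> X \<and> A \<inter> D \<in> \<Gamma> X) \<and>
     (\<forall>X Y f A. Polish_space X \<longrightarrow> Polish_space Y \<longrightarrow> Delta0_measurable 6 X Y f \<longrightarrow> A \<in> \<Gamma> Y \<longrightarrow>
        {x \<in> topspace X. f x \<in> A} \<in> \<Gamma> X)"

text \<open>Membership in \<open>\<Gamma>\<close> of a subset of a Polish space over another type, by transport along a
  homeomorphism; the choice of the copy is immaterial (lemmas \<open>in_pointclass_iff\<close>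
  and \<open>in_pointclass_same_type\<close>).\<close>

definition in_pointclass :: "pointclass \<Rightarrow> 'a topology \<Rightarrow> 'a set \<Rightarrow> bool" where
  "in_pointclass \<Gamma> X A \<longleftrightarrow>
     A \<subseteq> topspace X \<and> (\<exists>Y f. homeomorphic_map X Y f \<and> f ` A \<in> \<Gamma> Y)"

lemma Polish_space_homeomorphic:
  assumes "homeomorphic_map X Y f"
  shows "Polish_space X \<longleftrightarrow> Polish_space Y"
  using assms homeomorphic_completely_metrizable_space homeomorphic_separable_space
    homeomorphic_map_imp_homeomorphic_space unfolding Polish_space_def by blast

lemma in_pointclass_iff:
  assumes pc: "is_pointclass \<Gamma>" and h: "homeomorphic_map X Y f" and A: "A \<subseteq> topspace X"
  shows "in_pointclass \<Gamma> X A \<longleftrightarrow> f ` A \<in> \<Gamma> Y"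
proof
  assume "in_pointclass \<Gamma> X A"
  then obtain Z g where g: "homeomorphic_map X Z g" and gA: "g ` A \<in> \<Gamma> Z"
    unfolding in_pointclass_def by blast
  from h obtain f' where f': "homeomorphic_maps X Y f f'"
    using homeomorphic_map_maps by blast
  have "Polish_space Z" using pc gA unfolding is_pointclass_def by blast
  then have Y: "Polish_space Y"
    using g h Polish_space_homeomorphic by blast
  have c: "continuous_map Y Z (g \<circ> f')"
    using f' g homeomorphic_imp_continuous_map
    by (metis continuous_map_compose homeomorphic_maps_def)
  have inj: "inj_on g (topspace X)"
    using g homeomorphic_imp_injective_map by blast
  have f'Y: "f' y \<in> topspace X" "f (f' y) = y" if "y \<in> topspace Y" for y
    using f' that unfolding homeomorphic_maps_def continuous_map_def by auto
  have ff: "f x \<in> topspace Y" "f' (f x) = x" if "x \<in> topspace X" for x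
    using f' that unfolding homeomorphic_maps_def continuous_map_def by auto
  have eq: "{y \<in> topspace Y. (g \<circ> f') y \<in> g ` A} = f ` A"
  proof (intro equalityI subsetI)
    fix y assume "y \<in> {y \<in> topspace Y. (g \<circ> f') y \<in> g ` A}"
    then have y: "y \<in> topspace Y" and "g (f' y) \<in> g ` A" by auto
    then have "f' y \<in> A"
      using inj f'Y(1)[OF y] A by (meson inj_on_image_mem_iff)
    then show "y \<in> f ` A" using f'Y(2)[OF y] by (metis imageI)
  next
    fix y assume "y \<in> f ` A"
    then show "y \<in> {y \<in> topspace Y. (g \<circ> f') y \<in> g ` A}" using ff A by auto
  qed
  have "{y \<in> topspace Y. (g \<circ> f') y \<in> g ` A} \<in> \<Gamma> Y"
    using pc Y \<open>Polish_space Z\<close> c gA unfolding is_pointclass_def by blast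
  then show "f ` A \<in> \<Gamma> Y" by (simp only: eq)
next
  assume "f ` A \<in> \<Gamma> Y"
  then show "in_pointclass \<Gamma> X A" using h A unfolding in_pointclass_def by blast
qed

lemma in_pointclass_same_type:
  assumes "is_pointclass \<Gamma>"
  shows "in_pointclass \<Gamma> X A \<longleftrightarrow> A \<in> \<Gamma> X"
proof -
  have h: "homeomorphic_map X X id" by simp
  have sub: "A \<in> \<Gamma> X \<Longrightarrow> A \<subseteq> topspace X" using assms unfolding is_pointclass_def by blast
  show ?thesis
  proof (cases "A \<subseteq> topspace X")
    case True
    then show ?thesis using in_pointclass_iff[OF assms h True] by simp
  next
    case False
    then show ?thesis using sub by (meson in_pointclass_def)
  qed
qed

lemma Polish_space_copy:
  assumes "Polish_space X"
  obtains Y :: "(nat \<Rightarrow> nat) topology" and f where "homeomorphic_map X Y f" "Polish_space Y"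
proof -
  obtain M d where M: "Metric_space M d" and X: "X = Metric_space.mtopology M d"
    using assms unfolding Polish_space_def completely_metrizable_space_def by blast
  interpret Metric_space M d by (rule M)
  obtain D where D: "countable D" "D \<subseteq> M" "mtopology closure_of D = M"
    using assms unfolding Polish_space_def separable_space_def X by auto
  define e where "e = (\<lambda>x n. let (i, k) = prod_decode n in
      if d (from_nat_into D i) x < inverse (real (Suc k)) then 1 else (0::nat))"
  have inj: "inj_on e M"
  proof (rule inj_onI, rule ccontr)
    fix x y assume x: "x \<in> M" and y: "y \<in> M" and exy: "e x = e y" and "x \<noteq> y"
    then have "d x y > 0" by simp
    then obtain k where k: "inverse (real (Suc k)) < d x y / 2"
      using reals_Archimedean[of "d x y / 2"] by auto
    have "x \<in> mtopology closure_of D" using x D by simp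
    then have "\<forall>r>0. \<exists>a\<in>D. d x a < r"
      unfolding metric_closure_of by (auto simp: in_mball)
    moreover have "inverse (real (Suc k)) > 0" by simp
    ultimately obtain a where a: "a \<in> D" "d x a < inverse (real (Suc k))" by blast
    obtain i where i: "from_nat_into D i = a"
      using a D(1) by (metis from_nat_into_surj)
    have aM: "a \<in> M" using a D by blast
    have "e x (prod_encode (i, k)) = 1"
      using a i commute by (simp add: e_def)
    then have "e y (prod_encode (i, k)) = 1" by (simp only: exy)
    then have "d a y < inverse (real (Suc k))"
      using i by (simp add: e_def split: if_splits)
    then have "d x y < d x y"
      using triangle[OF x aM y] a(2) k by linarith
    then show False by simp
  qed
  define g where "g = inv_into M e"
  define Y where "Y = pullback_topology (e ` M) g X"
  have top: "topspace X = M" by (simp add: X)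
  have g: "g (e x) = x" if "x \<in> M" for x using inj that by (simp add: g_def)
  have tY: "topspace Y = e ` M"
    unfolding Y_def topspace_pullback_topology top using g by auto
  have "continuous_map X Y e"
    unfolding Y_def
  proof (rule continuous_map_pullback')
    show "continuous_map X X (g \<circ> e)"
      by (rule continuous_map_eq[OF continuous_map_id]) (simp add: top g)
    show "topspace X \<subseteq> e -` e ` M" by (auto simp: top)
  qed
  moreover have "continuous_map Y X g"
    unfolding Y_def using continuous_map_pullback[OF continuous_map_id] by fastforce
  ultimately have "homeomorphic_maps X Y e g"
    unfolding homeomorphic_maps_def using g tY top by auto
  then have "homeomorphic_map X Y e" using homeomorphic_maps_map by blast
  then show ?thesis using assms Polish_space_homeomorphic that by blast
qed

section \<open>Games with moves in a set\<close>

definition power_space :: "nat set \<Rightarrow> 'i set \<Rightarrow> ('i \<Rightarrow> nat) topology" where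
  "power_space S I = product_topology (\<lambda>_. discrete_topology S) I"

text \<open>A strategy maps every finite sequence of moves to a move; player I moves at the even
  and player II at the odd stages.\<close>

definition strategy :: "nat set \<Rightarrow> (nat list \<Rightarrow> nat) \<Rightarrow> bool" where
  "strategy S \<sigma> \<longleftrightarrow> (\<forall>p \<in> lists S. \<sigma> p \<in> S)"

definition winning_I :: "nat set \<Rightarrow> (nat \<Rightarrow> nat) set \<Rightarrow> (nat list \<Rightarrow> nat) \<Rightarrow> bool" where
  "winning_I S A \<sigma> \<longleftrightarrow> strategy S \<sigma> \<and>
     (\<forall>x. range x \<subseteq> S \<and> (\<forall>n. x (2 * n) = \<sigma> (map x [0..<2 * n])) \<longrightarrow> x \<in> A)"

definition winning_II :: "nat set \<Rightarrow> (nat \<Rightarrow> nat) set \<Rightarrow> (nat list \<Rightarrow> nat) \<Rightarrow> bool" where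
  "winning_II S A \<tau> \<longleftrightarrow> strategy S \<tau> \<and>
     (\<forall>x. range x \<subseteq> S \<and> (\<forall>n. x (2 * n + 1) = \<tau> (map x [0..<2 * n + 1])) \<longrightarrow> x \<notin> A)"

definition determined :: "nat set \<Rightarrow> (nat \<Rightarrow> nat) set \<Rightarrow> bool" where
  "determined S A \<longleftrightarrow> (\<exists>\<sigma>. winning_I S A \<sigma>) \<or> (\<exists>\<tau>. winning_II S A \<tau>)"

definition pointclass_determinacy :: "pointclass \<Rightarrow> nat set \<Rightarrow> bool" where
  "pointclass_determinacy \<Gamma> S \<longleftrightarrow>
     (\<forall>A. A \<in> \<Gamma> (power_space S (UNIV :: nat set)) \<longrightarrow> determined S A)"

section \<open>The shift action and invariant determinacy\<close>

definition shift :: "('g, 'b) monoid_scheme \<Rightarrow> 'g \<Rightarrow> ('g \<Rightarrow> nat) \<Rightarrow> ('g \<Rightarrow> nat)" where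
  "shift G g x = (\<lambda>h \<in> carrier G. x (inv\<^bsub>G\<^esub> g \<otimes>\<^bsub>G\<^esub> h))"

definition shift_orbit_rel ::
    "('g, 'b) monoid_scheme \<Rightarrow> nat set \<Rightarrow> (('g \<Rightarrow> nat) \<times> ('g \<Rightarrow> nat)) set" where
  "shift_orbit_rel G S =
     {(x, y). x \<in> topspace (power_space S (carrier G)) \<and> (\<exists>g \<in> carrier G. y = shift G g x)}"

definition invariant_under :: "('x \<times> 'x) set \<Rightarrow> 'x set \<Rightarrow> bool" where
  "invariant_under E A \<longleftrightarrow> (\<forall>x y. (x, y) \<in> E \<longrightarrow> x \<in> A \<longrightarrow> y \<in> A)"

text \<open>The homeomorphism induced by an enumeration \<open>\<pi>\<close>: \<open>enum_map G \<pi> x (\<pi> n) = x n\<close>.\<close>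

definition enum_map :: "('g, 'b) monoid_scheme \<Rightarrow> (nat \<Rightarrow> 'g) \<Rightarrow> (nat \<Rightarrow> nat) \<Rightarrow> ('g \<Rightarrow> nat)" where
  "enum_map G \<pi> x = (\<lambda>h \<in> carrier G. x (inv_into UNIV \<pi> h))"

definition invariant_determinacy ::
    "pointclass \<Rightarrow> ('g, 'b) monoid_scheme \<Rightarrow> nat set \<Rightarrow> bool" where
  "invariant_determinacy \<Gamma> G S \<longleftrightarrow>
     (\<forall>A \<pi>. in_pointclass \<Gamma> (power_space S (carrier G)) A \<longrightarrow>
        invariant_under (shift_orbit_rel G S) A \<longrightarrow>
        bij_betw \<pi> UNIV (carrier G) \<longrightarrow>
        determined S {x \<in> topspace (power_space S UNIV). enum_map G \<pi> x \<in> A})"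

section \<open>Weak amenability\<close>

definition weakly_amenable :: "('g, 'b) monoid_scheme \<Rightarrow> bool" where
  "weakly_amenable H \<longleftrightarrow> group H \<and> countable (carrier H) \<and>
     (finite (carrier H) \<or>
      (\<exists>r. equiv (carrier H) r \<and>
         infinite (carrier H // r) \<and>
         (\<forall>h \<in> carrier H. \<exists>b::nat. \<forall>C \<in> carrier H // r.
            finite {C' \<in> carrier H // r. (h <#\<^bsub>H\<^esub> C) \<inter> C' \<noteq> {}} \<and>
            card {C' \<in> carrier H // r. (h <#\<^bsub>H\<^esub> C) \<inter> C' \<noteq> {}} \<le> b) \<and>
         (\<exists>A :: nat \<Rightarrow> 'g set set.
            incseq A \<and> (\<forall>n. finite (A n)) \<and> (\<Union>n. A n) = carrier H // r \<and>
            (\<forall>h \<in> carrier H.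
               (\<lambda>n. real (card {C \<in> A n. h <#\<^bsub>H\<^esub> C \<subseteq> \<Union>(A n)}) / real (card (A n)))
                 \<longlonglongrightarrow> 1))))"

end

theory Submission
  imports Defs
begin

text \<open>Choose the enumeration \<open>\<pi>\<close> of \<open>G\<close> so that the original game is played on the
  coordinates \<open>\<pi> (4 * k)\<close> and \<open>\<pi> (4 * k + 1)\<close>, while player I promises to play \<open>0\<close> on all
  \<open>\<pi> (4 * k + 2)\<close> and player II promises to play \<open>1\<close> on all \<open>\<pi> (4 * k + 3)\<close>. If every
  \<open>g \<noteq> \<one>\<close> moves some \<open>\<pi> (4 * j + 2)\<close> to some \<open>\<pi> (4 * k + 3)\<close>, then a point at which I keeps the
  promise and a nontrivial translate of it at which II keeps the promise cannot coexist. Hence an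
  orbit meeting both promise sets contains exactly one point at which both are kept, and the
  original play is decoded from it by a \<open>\<Delta>\<^sup>0\<^sub>3\<close>-measurable function. Orbits meeting only one of
  the promise sets are won by the player who kept the promise. Such an enumeration is built
  greedily: given \<open>g \<noteq> \<one>\<close> and a finite set of used elements, all but finitely many \<open>a\<close> have both
  \<open>a\<close> and \<open>g a\<close> unused.\<close>

section \<open>Countable unions of closed sets in the finite Borel hierarchy\<close>

text \<open>\<open>Sigma0_Union\<close> collects complements, so each closed \<open>C i\<close> is
  presented as the complement of its open complement, a set of level 1; hence the bound 2.\<close>

lemma Sigma0_fsigma:
  assumes "fsigma_in X A" "2 \<le> n"
  shows "Sigma0 X n A"
proof -
  obtain C :: "nat \<Rightarrow> 'a set" where C: "\<And>i. closedin X (C i)" "\<Union> (range C) = A"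
    using assms(1) unfolding fsigma_in_ascending by blast
  have "Sigma0 X n (\<Union>i. topspace X - (topspace X - C i))"
    by (intro Sigma0_Union[where m = "\<lambda>_. 1"] Sigma0_open openin_diff openin_topspace C(1))
      (use assms(2) in auto)
  moreover have "(\<Union>i. topspace X - (topspace X - C i)) = A"
    using C closedin_subset by fast
  ultimately show ?thesis by simp
qed

lemma Sigma0_complement:
  assumes "Sigma0 X m A" "m < n"
  shows "Sigma0 X n (topspace X - A)"
proof -
  have "1 \<le> m" using assms(1) by (cases) auto
  then show ?thesis
    using Sigma0_Union[of n "\<lambda>_. m" X "\<lambda>_. A"] assms by simp
qed

text \<open>An F-sigma set has level 2 and its complement costs one more level, so both are
  available from 3 on.\<close>

lemma Delta0_fsigma:
  assumes "fsigma_in X A" "3 \<le> n"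
  shows "Delta0 X n A" "Delta0 X n (topspace X - A)"
proof -
  have sub: "A \<subseteq> topspace X" using assms(1) fsigma_in_subset by blast
  have S: "Sigma0 X n A" using assms by (intro Sigma0_fsigma) auto
  have P: "Sigma0 X n (topspace X - A)"
    using Sigma0_complement[OF Sigma0_fsigma[OF assms(1) order.refl]] assms(2) by simp
  have eq: "topspace X - (topspace X - A) = A" using sub by blast
  show "Delta0 X n A" "Delta0 X n (topspace X - A)"
    using S P sub eq unfolding Delta0_def Pi0_def by auto
qed

section \<open>Sequence spaces\<close>

lemma topspace_power_space_UNIV: "topspace (power_space S UNIV) = {x. range x \<subseteq> S}"
  by (auto simp: power_space_def)

lemma continuous_map_power_space_coordinate:
  assumes "i \<in> I"
  shows "continuous_map (power_space S I) (discrete_topology S) (\<lambda>x. x i)"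
  using assms unfolding power_space_def by (rule continuous_map_product_projection)

lemma continuous_map_power_space_reindex:
  assumes "\<And>n. p n \<in> I"
  shows "continuous_map (power_space S I) (power_space S UNIV) (\<lambda>x. x \<circ> p)"
  using continuous_map_power_space_coordinate[of _ I S] assms
  by (simp add: power_space_def continuous_map_componentwise_UNIV)

lemma closedin_power_space_coordinates:
  "closedin (power_space S UNIV) {x \<in> topspace (power_space S UNIV). \<forall>k::nat. x (f k) = c}"
proof -
  \<comment> \<open>Intersecting \<open>{c}\<close> with \<open>S\<close> gives a closed set of the
    discrete space on \<open>S\<close> even if \<open>c\<close> lies outside
    \<open>S\<close>.\<close>
  have "closedin (power_space S UNIV)
      {x \<in> topspace (power_space S UNIV). x (f k) \<in> {c} \<inter> S}" for k
    by (rule closedin_continuous_map_preimage[OF continuous_map_power_space_coordinate]) auto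
  then have "closedin (power_space S UNIV)
      (\<Inter>k. {x \<in> topspace (power_space S UNIV). x (f k) \<in> {c} \<inter> S})"
    by (intro closedin_Inter) auto
  moreover have "(\<Inter>k. {x \<in> topspace (power_space S UNIV). x (f k) \<in> {c} \<inter> S})
      = {x \<in> topspace (power_space S UNIV). \<forall>k. x (f k) = c}"
    by (auto simp: topspace_power_space_UNIV)
  ultimately show ?thesis by simp
qed

section \<open>Padding a game\<close>

text \<open>Moves \<open>2 * k\<close> and \<open>2 * k + 1\<close> of the original game sit at
  \<open>4 * k\<close> and \<open>4 * k + 1\<close>; parity is kept, so each is still made by the
  same player.\<close>

definition decode_index :: "nat \<Rightarrow> nat" where
  "decode_index m = 4 * (m div 2) + m mod 2"

text \<open>\<open>x\<close> supplies the original moves. At residues 2 and 3 the inserted move is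
  computed by \<open>r\<close> from the padded history, so \<open>r\<close> can encode both a
  promised constant and the reply of a strategy.\<close>

function padded_play :: "(nat list \<Rightarrow> nat) \<Rightarrow> (nat \<Rightarrow> nat) \<Rightarrow> nat \<Rightarrow> nat" where
  "padded_play r x n =
     (if n mod 4 < 2 then x (2 * (n div 4) + n mod 4) else r (map (padded_play r x) [0..<n]))"
  by pat_completeness auto
termination by (relation "Wellfounded.measure (\<lambda>(r, x, n). n)") auto

declare padded_play.simps [simp del]

lemma padded_play_residue:
  "padded_play r x (4 * k) = x (2 * k)"
  "padded_play r x (4 * k + 1) = x (2 * k + 1)"
  "padded_play r x (4 * k + 2) = r (map (padded_play r x) [0..<4 * k + 2])"
  "padded_play r x (4 * k + 3) = r (map (padded_play r x) [0..<4 * k + 3])"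
proof -
  have "(4 * k + 1) mod 4 = 1" "(4 * k + 1) div 4 = k" "(4 * k + 2) mod 4 = 2" "(4 * k + 3) mod 4 = 3"
    by presburger+
  note m = this
  show "padded_play r x (4 * k) = x (2 * k)"
    by (subst padded_play.simps) simp
  show "padded_play r x (4 * k + 1) = x (2 * k + 1)"
    by (subst padded_play.simps) (simp only: m, simp)
  show "padded_play r x (4 * k + 2) = r (map (padded_play r x) [0..<4 * k + 2])"
    "padded_play r x (4 * k + 3) = r (map (padded_play r x) [0..<4 * k + 3])"
    by (subst padded_play.simps, simp only: m, simp)+
qed

lemma padded_play_decode: "padded_play r x \<circ> decode_index = x"
proof
  fix m :: nat
  show "(padded_play r x \<circ> decode_index) m = x m"
    using padded_play_residue(1,2)[of r x]
    by (cases "even m") (auto elim!: evenE oddE simp: decode_index_def)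
qed

text \<open>The bound on \<open>m\<close> counts the positions below \<open>n\<close> of residue 0
  or 1, that is, the original moves consulted by the first \<open>n\<close> padded moves.\<close>

lemma padded_play_cong:
  assumes "\<And>i. i < m \<Longrightarrow> x i = x' i" "2 * (n div 4) + min 2 (n mod 4) \<le> m"
  shows "map (padded_play r x) [0..<n] = map (padded_play r x') [0..<n]"
proof -
  have "padded_play r x i = padded_play r x' i" if "i < n" for i
    using that
  proof (induction i rule: less_induct)
    case (less i)
    have "map (padded_play r x) [0..<i] = map (padded_play r x') [0..<i]"
      using less by simp
    moreover have "2 * (i div 4) + i mod 4 < m" if "i mod 4 < 2"
    proof (cases "i div 4 = n div 4")
      case True
      then have "i mod 4 < n mod 4"
        using less.prems div_mult_mod_eq[of i 4] div_mult_mod_eq[of n 4] by linarith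
      then show ?thesis using that True assms(2) by linarith
    next
      case False
      then have "i div 4 < n div 4" using less.prems by (simp add: div_le_mono order_less_le)
      then show ?thesis using that assms(2) by linarith
    qed
    ultimately show ?case
      using assms(1) by (simp only: padded_play.simps[of _ _ i] split: if_split) blast
  qed
  then show ?thesis by simp
qed

lemma padded_play_in:
  assumes "range x \<subseteq> S" "\<And>l. l \<in> lists S \<Longrightarrow> r l \<in> S"
  shows "padded_play r x n \<in> S"
proof (induction n rule: less_induct)
  case (less n)
  then have "map (padded_play r x) [0..<n] \<in> lists S" by auto
  then show ?case
    using assms by (subst padded_play.simps) (auto simp del: in_lists_conv_set)
qed

text \<open>Completes a finite position by zeros so that \<open>padded_play\<close> applies to it;
  under the bound of \<open>padded_play_list_play\<close> the zeros are not consulted.\<close>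

definition list_play :: "nat list \<Rightarrow> nat \<Rightarrow> nat" where
  "list_play p i = (if i < length p then p ! i else 0)"

lemma range_list_play: "p \<in> lists S \<Longrightarrow> 0 \<in> S \<Longrightarrow> range (list_play p) \<subseteq> S"
  by (auto simp: list_play_def)

lemma padded_play_list_play:
  assumes "2 * (n div 4) + min 2 (n mod 4) \<le> m"
  shows "map (padded_play r (list_play (map x [0..<m]))) [0..<n] = map (padded_play r x) [0..<n]"
  by (rule padded_play_cong[OF _ assms]) (simp add: list_play_def)

text \<open>Player I imagines a padded game against an opponent who plays 1 at every
  \<open>4 * k + 3\<close>. All inserted moves can then be computed by I alone, and the moves of
  \<open>\<sigma>\<close> at \<open>4 * k\<close> form a strategy in the original game.\<close>

lemma padded_winning_I:
  assumes S: "0 \<in> S" "1 \<in> S" and win: "winning_I S B \<sigma>"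
    and B: "\<And>y. y \<in> B \<Longrightarrow> range y \<subseteq> S \<Longrightarrow> (\<And>k. y (4 * k + 3) = 1) \<Longrightarrow> y \<circ> decode_index \<in> A"
  shows "\<exists>\<sigma>'. winning_I S A \<sigma>'"
proof -
  \<comment> \<open>At residue 2 it is I's turn and \<open>\<sigma>\<close> answers; the other
    residue at which \<open>r\<close> is consulted is 3, where the opponent's promised 1 is
    inserted.\<close>
  define r where "r = (\<lambda>l. if length l mod 4 = 2 then \<sigma> l else 1)"
  \<comment> \<open>After \<open>2 * k\<close> original moves I is to move at padded position
    \<open>4 * k\<close>, twice the length of \<open>p\<close>.\<close>
  define \<sigma>' where
    "\<sigma>' = (\<lambda>p. \<sigma> (map (padded_play r (list_play p)) [0..<2 * length p]))"
  have \<sigma>: "\<sigma> l \<in> S" if "l \<in> lists S" for l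
    using win that unfolding winning_I_def strategy_def by blast
  have r: "r l \<in> S" if "l \<in> lists S" for l
    using that \<sigma> S by (simp add: r_def)
  have "strategy S \<sigma>'"
    unfolding strategy_def
  proof
    fix p assume "p \<in> lists S"
    then have "padded_play r (list_play p) i \<in> S" for i
      by (intro padded_play_in range_list_play r S(1))
    then show "\<sigma>' p \<in> S" unfolding \<sigma>'_def by (intro \<sigma>) auto
  qed
  moreover have "x \<in> A"
    if x: "range x \<subseteq> S" and cons: "\<And>n. x (2 * n) = \<sigma>' (map x [0..<2 * n])" for x
  proof -
    define y where "y = padded_play r x"
    have yS: "range y \<subseteq> S" using padded_play_in[OF x r] by (auto simp: y_def)
    \<comment> \<open>I's padded turns alternate between copied moves (even \<open>n\<close>), where
      \<open>cons\<close> applies, and inserted ones (odd \<open>n\<close>), where \<open>r\<close>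
      follows \<open>\<sigma>\<close> by definition.\<close>
    have "y (2 * n) = \<sigma> (map y [0..<2 * n])" for n
    proof (cases "even n")
      case True
      then obtain k where k: "n = 2 * k" by blast
      have "y (4 * k) = x (2 * k)" unfolding y_def by (rule padded_play_residue)
      also have "\<dots> = \<sigma> (map (padded_play r (list_play (map x [0..<2 * k]))) [0..<4 * k])"
        unfolding cons \<sigma>'_def by simp
      also have "\<dots> = \<sigma> (map y [0..<4 * k])"
        by (subst padded_play_list_play) (auto simp: y_def)
      finally show ?thesis using k by simp
    next
      case False
      then obtain k where k: "n = 2 * k + 1" using oddE by blast
      then have n: "2 * n = 4 * k + 2" by simp
      have "(4 * k + 2) mod 4 = 2" by presburger
      then have "r (map y [0..<4 * k + 2]) = \<sigma> (map y [0..<4 * k + 2])"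
        by (simp only: r_def length_map length_upt) simp
      then show ?thesis unfolding n y_def padded_play_residue(3) .
    qed
    moreover have "y (4 * k + 3) = 1" for k
    proof -
      have "(4 * k + 3) mod 4 = 3" by presburger
      then show ?thesis
        unfolding y_def padded_play_residue(4) by (simp only: r_def length_map length_upt) simp
    qed
    ultimately have "y \<circ> decode_index \<in> A"
      using B yS win unfolding winning_I_def by blast
    then show ?thesis by (simp add: y_def padded_play_decode)
  qed
  ultimately show ?thesis unfolding winning_I_def by blast
qed

text \<open>The mirror image: II simulates an opponent who plays 0 at every \<open>4 * k + 2\<close>
  and inserts the replies of \<open>\<tau>\<close> at \<open>4 * k + 3\<close>.\<close>

lemma padded_winning_II:
  assumes S: "0 \<in> S" and win: "winning_II S B \<tau>"
    and B: "\<And>y. y \<notin> B \<Longrightarrow> range y \<subseteq> S \<Longrightarrow> (\<And>k. y (4 * k + 2) = 0) \<Longrightarrow> y \<circ> decode_index \<notin> A"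
  shows "\<exists>\<tau>'. winning_II S A \<tau>'"
proof -
  define r where "r = (\<lambda>l. if length l mod 4 = 2 then 0 else \<tau> l)"
  \<comment> \<open>After \<open>2 * k + 1\<close> original moves II is to move at padded position
    \<open>4 * k + 1\<close>, which is \<open>2 * length p - 1\<close>.\<close>
  define \<tau>' where
    "\<tau>' = (\<lambda>p. \<tau> (map (padded_play r (list_play p)) [0..<2 * length p - 1]))"
  have \<tau>: "\<tau> l \<in> S" if "l \<in> lists S" for l
    using win that unfolding winning_II_def strategy_def by blast
  have r: "r l \<in> S" if "l \<in> lists S" for l
    using that \<tau> S by (simp add: r_def)
  have "strategy S \<tau>'"
    unfolding strategy_def
  proof
    fix p assume "p \<in> lists S"
    then have "padded_play r (list_play p) i \<in> S" for i
      by (intro padded_play_in range_list_play r S)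
    then show "\<tau>' p \<in> S" unfolding \<tau>'_def by (intro \<tau>) auto
  qed
  moreover have "x \<notin> A"
    if x: "range x \<subseteq> S" and cons: "\<And>n. x (2 * n + 1) = \<tau>' (map x [0..<2 * n + 1])" for x
  proof -
    define y where "y = padded_play r x"
    have yS: "range y \<subseteq> S" using padded_play_in[OF x r] by (auto simp: y_def)
    have "y (2 * n + 1) = \<tau> (map y [0..<2 * n + 1])" for n
    proof (cases "even n")
      case True
      then obtain k where k: "n = 2 * k" by blast
      have "y (4 * k + 1) = x (2 * k + 1)" unfolding y_def by (rule padded_play_residue)
      also have "\<dots> = \<tau> (map (padded_play r (list_play (map x [0..<2 * k + 1]))) [0..<4 * k + 1])"
        unfolding cons \<tau>'_def by simp
      also have "\<dots> = \<tau> (map y [0..<4 * k + 1])"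
      proof (subst padded_play_list_play)
        show "2 * ((4 * k + 1) div 4) + min 2 ((4 * k + 1) mod 4) \<le> 2 * k + 1" by presburger
      qed (simp only: y_def)
      finally show ?thesis using k by simp
    next
      case False
      then obtain k where k: "n = 2 * k + 1" using oddE by blast
      then have n: "2 * n + 1 = 4 * k + 3" by simp
      have "(4 * k + 3) mod 4 = 3" by presburger
      then have "r (map y [0..<4 * k + 3]) = \<tau> (map y [0..<4 * k + 3])"
        by (simp only: r_def length_map length_upt) simp
      then show ?thesis unfolding n y_def padded_play_residue(4) .
    qed
    moreover have "y (4 * k + 2) = 0" for k
    proof -
      have "(4 * k + 2) mod 4 = 2" by presburger
      then show ?thesis
        unfolding y_def padded_play_residue(3) by (simp only: r_def length_map length_upt) simp
    qed
    ultimately have "y \<circ> decode_index \<notin> A"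
      using B yS win unfolding winning_II_def by blast
    then show ?thesis by (simp add: y_def padded_play_decode)
  qed
  ultimately show ?thesis unfolding winning_II_def by blast
qed

section \<open>Decoding along the orbits of a group of permutations\<close>

text \<open>\<open>Q\<close> stands for the shift action carried over to the indices, acting by
  \<open>y \<circ> q\<close>. Closure, identity and right inverses make it a group of
  permutations.\<close>

locale separating_permutations =
  fixes Q :: "(nat \<Rightarrow> nat) set" and S :: "nat set"
  assumes countable_Q: "countable Q"
    and id_Q: "id \<in> Q"
    and comp_Q: "\<And>p q. p \<in> Q \<Longrightarrow> q \<in> Q \<Longrightarrow> p \<circ> q \<in> Q"
    and inverse_Q: "\<And>p. p \<in> Q \<Longrightarrow> \<exists>q\<in>Q. p \<circ> q = id"
    and separating: "\<And>q. q \<in> Q \<Longrightarrow> q \<noteq> id \<Longrightarrow> \<exists>j k. q (4 * k + 3) = 4 * j + 2"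
    and zero_S: "0 \<in> S" and one_S: "1 \<in> S"
begin

abbreviation N :: "(nat \<Rightarrow> nat) topology" where
  "N \<equiv> power_space S UNIV"

definition promise_I :: "(nat \<Rightarrow> nat) set" where
  "promise_I = {y \<in> topspace N. \<forall>k. y (4 * k + 2) = 0}"

definition promise_II :: "(nat \<Rightarrow> nat) set" where
  "promise_II = {y \<in> topspace N. \<forall>k. y (4 * k + 3) = 1}"

text \<open>As \<open>Q\<close> is a group, this is the union of the orbits in \<open>N\<close> that
  meet \<open>P\<close>.\<close>

definition saturation :: "(nat \<Rightarrow> nat) set \<Rightarrow> (nat \<Rightarrow> nat) set" where
  "saturation P = {y \<in> topspace N. \<exists>q\<in>Q. y \<circ> q \<in> P}"

text \<open>By \<open>promises_unique\<close> the \<open>SOME\<close> has exactly one candidate. The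
  constant 0 is a default that keeps the function total with values in \<open>N\<close>.\<close>

definition orbit_decode :: "(nat \<Rightarrow> nat) \<Rightarrow> nat \<Rightarrow> nat" where
  "orbit_decode y = (if y \<in> saturation (promise_I \<inter> promise_II)
     then y \<circ> (SOME q. q \<in> Q \<and> y \<circ> q \<in> promise_I \<inter> promise_II) \<circ> decode_index
     else (\<lambda>_. 0))"

section \<open>Orbits and the promise sets\<close>

lemma comp_topspace: "y \<in> topspace N \<Longrightarrow> y \<circ> q \<in> topspace N"
  by (auto simp: topspace_power_space_UNIV)

text \<open>If the inverse of \<open>p\<close> followed after \<open>q\<close> were not the
  identity, \<open>separating\<close> would give \<open>q (4 * k + 3) = p (4 * j + 2)\<close>, an
  index at which \<open>y\<close> has to be both 1 and 0.\<close>

lemma promises_unique: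
  assumes p: "p \<in> Q" "y \<circ> p \<in> promise_I" and q: "q \<in> Q" "y \<circ> q \<in> promise_II"
  shows "p = q"
proof -
  obtain r where r: "r \<in> Q" "p \<circ> r = id" using inverse_Q p(1) by blast
  have pr: "p (r n) = n" for n using r(2) by (metis comp_apply id_apply)
  have "r \<circ> q = id"
  proof (rule ccontr)
    assume "r \<circ> q \<noteq> id"
    then obtain j k where jk: "(r \<circ> q) (4 * k + 3) = 4 * j + 2"
      using separating comp_Q r(1) q(1) by blast
    have "y (q (4 * k + 3)) = 1" using q(2) by (simp add: promise_II_def)
    moreover have "y (p (4 * j + 2)) = 0" using p(2) by (simp add: promise_I_def)
    moreover have "p (4 * j + 2) = q (4 * k + 3)" using jk pr by (metis comp_apply)
    ultimately show False by simp
  qed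
  then have "p \<circ> (r \<circ> q) = p" by simp
  then show ?thesis using r(2) by (metis comp_assoc id_comp)
qed

lemma saturation_invariant:
  assumes "y \<in> saturation P" "p \<in> Q"
  shows "y \<circ> p \<in> saturation P"
proof -
  obtain q where q: "q \<in> Q" "y \<circ> q \<in> P" using assms(1) unfolding saturation_def by blast
  obtain r where r: "r \<in> Q" "p \<circ> r = id" using inverse_Q assms(2) by blast
  have "(y \<circ> p) \<circ> (r \<circ> q) = y \<circ> q" using r(2) by (metis comp_assoc id_comp)
  then show ?thesis
    using q r comp_Q assms(1) comp_topspace unfolding saturation_def
    by (metis (mono_tags, lifting) mem_Collect_eq)
qed

lemma saturation_invariant_iff:
  assumes "y \<in> topspace N" "p \<in> Q"
  shows "y \<circ> p \<in> saturation P \<longleftrightarrow> y \<in> saturation P"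
proof
  assume "y \<circ> p \<in> saturation P"
  then show "y \<in> saturation P"
    using assms comp_Q unfolding saturation_def by (auto simp: comp_assoc)
qed (use assms saturation_invariant in blast)

lemma orbit_decode_eq:
  assumes "y \<in> topspace N" "q \<in> Q" "y \<circ> q \<in> promise_I" "y \<circ> q \<in> promise_II"
  shows "orbit_decode y = y \<circ> q \<circ> decode_index"
proof -
  have "y \<in> saturation (promise_I \<inter> promise_II)"
    using assms unfolding saturation_def by blast
  moreover have "(SOME q. q \<in> Q \<and> y \<circ> q \<in> promise_I \<inter> promise_II) = q"
    by (rule some_equality) (use assms promises_unique in blast)+
  ultimately show ?thesis by (simp add: orbit_decode_def)
qed

text \<open>The witnesses for the two saturations coincide by \<open>promises_unique\<close>, so the
  orbit has a point at which both promises are kept.\<close>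

lemma saturation_Int:
  assumes "y \<in> saturation promise_I" "y \<in> saturation promise_II"
  obtains q where "q \<in> Q" "y \<circ> q \<in> promise_I" "y \<circ> q \<in> promise_II"
  using assms promises_unique unfolding saturation_def by blast

text \<open>Both \<open>y\<close> and \<open>y \<circ> p\<close> reach the same point of the orbit
  keeping both promises, the latter through \<open>r \<circ> q\<close> with \<open>r\<close> inverse
  to \<open>p\<close>.\<close>

lemma orbit_decode_invariant:
  assumes y: "y \<in> saturation promise_I" "y \<in> saturation promise_II" and p: "p \<in> Q"
  shows "orbit_decode (y \<circ> p) = orbit_decode y"
proof -
  have top: "y \<in> topspace N" using y unfolding saturation_def by blast
  obtain q where q: "q \<in> Q" "y \<circ> q \<in> promise_I" "y \<circ> q \<in> promise_II"
    using saturation_Int[OF y] .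
  obtain r where r: "r \<in> Q" "p \<circ> r = id" using inverse_Q p by blast
  have eq: "(y \<circ> p) \<circ> (r \<circ> q) = y \<circ> q" using r(2) by (metis comp_assoc id_comp)
  have "orbit_decode (y \<circ> p) = (y \<circ> p) \<circ> (r \<circ> q) \<circ> decode_index"
    by (rule orbit_decode_eq) (use q r eq comp_Q comp_topspace top in auto)
  then show ?thesis using orbit_decode_eq[OF top q] eq by simp
qed

section \<open>Borel complexity of the saturations and of the decoding\<close>

lemma closedin_promise_I: "closedin N promise_I"
  unfolding promise_I_def by (rule closedin_power_space_coordinates)

lemma closedin_promise_II: "closedin N promise_II"
  unfolding promise_II_def by (rule closedin_power_space_coordinates)

text \<open>A union over the countable \<open>Q\<close>. The extra condition \<open>R\<close> covers
  both saturations (\<open>R\<close> constantly true) and preimages under the decoding.\<close>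

lemma fsigma_saturation:
  assumes "closedin N P" "\<And>q. q \<in> Q \<Longrightarrow> fsigma_in N {y \<in> topspace N. R (y \<circ> q)}"
  shows "fsigma_in N {y \<in> topspace N. \<exists>q\<in>Q. y \<circ> q \<in> P \<and> R (y \<circ> q)}"
proof -
  have "fsigma_in N ({y \<in> topspace N. y \<circ> q \<in> P} \<inter> {y \<in> topspace N. R (y \<circ> q)})"
    if "q \<in> Q" for q
    by (intro fsigma_in_Int closed_imp_fsigma_in[OF closedin_continuous_map_preimage[where Y = N]]
        continuous_map_power_space_reindex assms that UNIV_I)
  then have "fsigma_in N
      (\<Union>q\<in>Q. {y \<in> topspace N. y \<circ> q \<in> P} \<inter> {y \<in> topspace N. R (y \<circ> q)})"
    using countable_Q by (intro fsigma_in_Union) auto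
  moreover have "(\<Union>q\<in>Q. {y \<in> topspace N. y \<circ> q \<in> P} \<inter> {y \<in> topspace N. R (y \<circ> q)})
      = {y \<in> topspace N. \<exists>q\<in>Q. y \<circ> q \<in> P \<and> R (y \<circ> q)}"
    by auto
  ultimately show ?thesis by simp
qed

lemma fsigma_saturation_closed: "closedin N P \<Longrightarrow> fsigma_in N (saturation P)"
  using fsigma_saturation[of P "\<lambda>_. True"] by (simp add: saturation_def)

text \<open>On the saturation of \<open>?Z\<close> the decoding is given by countably many
  continuous maps, each on a closed set, and elsewhere it is constant.\<close>

lemma orbit_decode_measurable:
  assumes N: "Polish_space N" and n: "3 \<le> n"
  shows "Delta0_measurable n N N orbit_decode"
  unfolding Delta0_measurable_def
proof (intro conjI allI impI)
  let ?Z = "promise_I \<inter> promise_II"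
  have Z: "closedin N ?Z" by (intro closedin_Int closedin_promise_I closedin_promise_II)
  have dec: "orbit_decode y = y \<circ> q \<circ> decode_index"
    if "y \<in> topspace N" "q \<in> Q" "y \<circ> q \<in> ?Z" for y q
    using that orbit_decode_eq by blast
  have zero: "orbit_decode y = (\<lambda>_. 0)" if "y \<notin> saturation ?Z" for y
    using that by (simp add: orbit_decode_def)
  have zero_top: "(\<lambda>_. 0) \<in> topspace N" using zero_S by (auto simp: topspace_power_space_UNIV)
  show "orbit_decode \<in> topspace N \<rightarrow> topspace N"
  proof
    fix y assume y: "y \<in> topspace N"
    show "orbit_decode y \<in> topspace N"
    proof (cases "y \<in> saturation ?Z")
      case True
      then obtain q where "q \<in> Q" "y \<circ> q \<in> ?Z" unfolding saturation_def by blast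
      then show ?thesis using dec y comp_topspace by simp
    qed (use zero zero_top in simp)
  qed
  fix U assume U: "openin N U"
  have cont: "continuous_map N N (\<lambda>y. y \<circ> q \<circ> decode_index)" for q
    using continuous_map_power_space_reindex[of "q \<circ> decode_index" UNIV S]
    by (simp add: comp_assoc)
  have metr: "metrizable_space N"
    using N completely_metrizable_imp_metrizable_space unfolding Polish_space_def by blast
  \<comment> \<open>If the default is outside \<open>U\<close>, the preimage lies in the saturation
    and is F-sigma, since open sets of a metrizable space are. Otherwise the same holds for the
    complement of the preimage, using the closed complement of \<open>U\<close>.\<close>
  show "Delta0 N n {y \<in> topspace N. orbit_decode y \<in> U}"
  proof (cases "(\<lambda>_. 0) \<in> U")
    case False
    have F: "fsigma_in N {y \<in> topspace N. \<exists>q\<in>Q. y \<circ> q \<in> ?Z \<and> y \<circ> q \<circ> decode_index \<in> U}"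
      using openin_continuous_map_preimage[OF cont U] open_imp_fsigma_in[OF metr]
      by (intro fsigma_saturation[OF Z]) blast
    have eq: "{y \<in> topspace N. \<exists>q\<in>Q. y \<circ> q \<in> ?Z \<and> y \<circ> q \<circ> decode_index \<in> U}
        = {y \<in> topspace N. orbit_decode y \<in> U}"
      (is "?E = ?V")
    proof (intro equalityI subsetI)
      fix y assume "y \<in> ?E"
      then show "y \<in> ?V" using dec by auto
    next
      fix y assume y: "y \<in> ?V"
      then have "y \<in> saturation ?Z" using zero[of y] False by force
      then obtain q where "q \<in> Q" "y \<circ> q \<in> ?Z" unfolding saturation_def by blast
      then show "y \<in> ?E" using y dec[of y q] by auto
    qed
    show ?thesis using Delta0_fsigma(1)[OF F n] unfolding eq .
  next
    case True
    have clU: "closedin N (topspace N - U)" using U by blast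
    have F: "fsigma_in N
        {y \<in> topspace N. \<exists>q\<in>Q. y \<circ> q \<in> ?Z \<and> y \<circ> q \<circ> decode_index \<in> topspace N - U}"
      using closedin_continuous_map_preimage[OF cont clU] closed_imp_fsigma_in
      by (intro fsigma_saturation[OF Z]) blast
    have eq: "topspace N -
        {y \<in> topspace N. \<exists>q\<in>Q. y \<circ> q \<in> ?Z \<and> y \<circ> q \<circ> decode_index \<in> topspace N - U}
        = {y \<in> topspace N. orbit_decode y \<in> U}" (is "topspace N - ?E = ?V")
    proof (intro equalityI subsetI)
      fix y assume y: "y \<in> topspace N - ?E"
      show "y \<in> ?V"
      proof (cases "y \<in> saturation ?Z")
        case sat: True
        then obtain q where q: "q \<in> Q" "y \<circ> q \<in> ?Z" unfolding saturation_def by blast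
        moreover have "y \<circ> q \<circ> decode_index \<in> topspace N" using y comp_topspace by blast
        ultimately show ?thesis using y dec[of y q] by auto
      qed (use y zero True in auto)
    next
      fix y assume "y \<in> ?V"
      then show "y \<in> topspace N - ?E" using dec by fastforce
    qed
    show ?thesis using Delta0_fsigma(2)[OF F n] unfolding eq .
  qed
qed

text \<open>\<open>B\<close> is the payoff of the padded game made invariant: orbits meeting both
  promise sets are judged by decoding, those meeting only \<open>promise_I\<close> belong to
  \<open>B\<close>, and those missing \<open>promise_I\<close> do not.\<close>

lemma invariant_coding:
  assumes \<Gamma>: "reasonable \<Gamma>" and A: "A \<in> \<Gamma> N"
  obtains B where "B \<in> \<Gamma> N" "\<And>y q. y \<in> B \<Longrightarrow> q \<in> Q \<Longrightarrow> y \<circ> q \<in> B"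
    "determined S B \<Longrightarrow> determined S A"
proof -
  define B where "B = ({y \<in> topspace N. orbit_decode y \<in> A} \<union> (topspace N - saturation promise_II))
    \<inter> saturation promise_I"
  have N: "Polish_space N" using \<Gamma> A unfolding reasonable_def is_pointclass_def by blast
  have "{y \<in> topspace N. orbit_decode y \<in> A} \<in> \<Gamma> N"
    using \<Gamma> A N orbit_decode_measurable[OF N, of 6] unfolding reasonable_def by auto
  moreover have "Delta0 N 6 (topspace N - saturation promise_II)" "Delta0 N 6 (saturation promise_I)"
    by (intro Delta0_fsigma fsigma_saturation_closed closedin_promise_I closedin_promise_II; simp)+
  ultimately have B\<Gamma>: "B \<in> \<Gamma> N"
    using \<Gamma> unfolding B_def reasonable_def by blast
  have inv: "y \<circ> q \<in> B" if "y \<in> B" "q \<in> Q" for y q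
  proof -
    have "y \<in> topspace N" using that(1) unfolding B_def by blast
    then show ?thesis
      using that orbit_decode_invariant saturation_invariant_iff comp_topspace
      unfolding B_def by auto
  qed
  have sat: "y \<in> saturation P" if "y \<in> topspace N" "y \<in> P" for y P
    using that id_Q unfolding saturation_def by force
  \<comment> \<open>Membership in \<open>B\<close> gives a point of the orbit keeping I's promise;
    as \<open>y\<close> itself keeps II's, uniqueness makes that point \<open>y\<close>.\<close>
  have winI: "y \<circ> decode_index \<in> A" if "y \<in> B" "y \<in> promise_II" for y
  proof -
    have top: "y \<in> topspace N" and I: "y \<in> saturation promise_I" using that(1) unfolding B_def by auto
    then obtain q where q: "q \<in> Q" "y \<circ> q \<in> promise_I" unfolding saturation_def by blast
    have "q = id" using promises_unique[OF q id_Q] that(2) by simp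
    then have "orbit_decode y = y \<circ> decode_index"
      using orbit_decode_eq[OF top id_Q] q that(2) by simp
    then show ?thesis using that sat top unfolding B_def by auto
  qed
  \<comment> \<open>Here \<open>y\<close> keeps I's promise, so it can only be outside
    \<open>B\<close> if its orbit meets \<open>promise_II\<close>; by uniqueness it does so at
    \<open>y\<close>.\<close>
  have winII: "y \<circ> decode_index \<notin> A" if "y \<notin> B" "y \<in> promise_I" for y
  proof -
    have top: "y \<in> topspace N" using that(2) unfolding promise_I_def by blast
    then have "y \<in> saturation promise_II" using that sat unfolding B_def by auto
    then obtain q where q: "q \<in> Q" "y \<circ> q \<in> promise_II" unfolding saturation_def by blast
    have "id = q" using promises_unique[OF id_Q _ q] that(2) by simp
    then have "orbit_decode y = y \<circ> decode_index"
      using orbit_decode_eq[OF top id_Q] q that(2) by auto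
    then show ?thesis using that sat top unfolding B_def by auto
  qed
  have "determined S A" if "determined S B"
    using that unfolding determined_def
  proof
    assume "\<exists>\<sigma>. winning_I S B \<sigma>"
    then have "\<exists>\<sigma>. winning_I S A \<sigma>"
      using padded_winning_I[OF zero_S one_S] winI
      unfolding promise_II_def topspace_power_space_UNIV by blast
    then show "(\<exists>\<sigma>. winning_I S A \<sigma>) \<or> (\<exists>\<tau>. winning_II S A \<tau>)" ..
  next
    assume "\<exists>\<tau>. winning_II S B \<tau>"
    then have "\<exists>\<tau>. winning_II S A \<tau>"
      using padded_winning_II[OF zero_S] winII
      unfolding promise_I_def topspace_power_space_UNIV by blast
    then show "(\<exists>\<sigma>. winning_I S A \<sigma>) \<or> (\<exists>\<tau>. winning_II S A \<tau>)" ..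
  qed
  then show thesis using that B\<Gamma> inv by blast
qed

end

section \<open>Separating enumerations\<close>

text \<open>\<open>U f n\<close> is the finite set used before stage \<open>n\<close>; the next
  element must avoid it and its translate by the inverse of \<open>g n\<close>. The sequence
  \<open>g\<close> may repeat values.\<close>

lemma (in group) disjoint_translates:
  assumes inf: "infinite (carrier G)" and g: "\<And>n::nat. g n \<in> carrier G" "\<And>n. g n \<noteq> \<one>"
  obtains a where "\<And>n. a n \<in> carrier G" "inj a" "inj (\<lambda>n. g n \<otimes> a n)"
    "\<And>m n. a m \<noteq> g n \<otimes> a n"
proof -
  define U where "U = (\<lambda>f n. f ` {..<n} \<union> (\<lambda>i. g i \<otimes> f i) ` {..<n})"
  define P where "P = (\<lambda>f n r. r \<in> carrier G \<and> r \<notin> U f n \<and> g n \<otimes> r \<notin> U f n)"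
  have "\<exists>f. \<forall>n. P f n (f n)"
  proof (rule dependent_wellorder_choice)
    fix r n and f f' :: "nat \<Rightarrow> 'a"
    assume "\<And>i. i < n \<Longrightarrow> f i = f' i"
    then have "U f n = U f' n" unfolding U_def by (intro arg_cong2[where f = "(\<union>)"] image_cong) auto
    then show "P f n r = P f' n r" by (simp add: P_def)
  next
    fix n :: nat and f :: "nat \<Rightarrow> 'a"
    have fin: "finite (U f n)" by (simp add: U_def)
    have "\<exists>r. r \<in> carrier G - (U f n \<union> (\<lambda>u. inv (g n) \<otimes> u) ` U f n)"
      using inf fin by (metis finite_Diff2 finite_UnI finite_imageI finite.emptyI ex_in_conv)
    then obtain r where r: "r \<in> carrier G" "r \<notin> U f n" "r \<notin> (\<lambda>u. inv (g n) \<otimes> u) ` U f n"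
      by blast
    have "r = inv (g n) \<otimes> (g n \<otimes> r)"
      using r(1) g(1)[of n] by (simp add: m_assoc[symmetric])
    then have "g n \<otimes> r \<notin> U f n" using r(3) by blast
    then show "\<exists>r. P f n r" using r by (auto simp: P_def)
  qed
  then obtain a where a: "\<And>n. P a n (a n)" by blast
  have car: "a n \<in> carrier G" for n using a by (simp add: P_def)
  have less: "a i \<noteq> a n" "a i \<noteq> g n \<otimes> a n" "g i \<otimes> a i \<noteq> a n" "g i \<otimes> a i \<noteq> g n \<otimes> a n"
    if "i < n" for i n
  proof -
    have "a i \<in> U a n" "g i \<otimes> a i \<in> U a n" using that by (auto simp: U_def)
    then show "a i \<noteq> a n" "a i \<noteq> g n \<otimes> a n" "g i \<otimes> a i \<noteq> a n" "g i \<otimes> a i \<noteq> g n \<otimes> a n"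
      using a[of n] by (auto simp: P_def)
  qed
  \<comment> \<open>The diagonal case is not covered by the greedy choice but by cancellation, as
    \<open>g n\<close> is not \<open>\<one>\<close>.\<close>
  have eq: "a n \<noteq> g n \<otimes> a n" for n
    using g[of n] car[of n] r_cancel_one' by metis
  show thesis
  proof
    show "inj a" by (rule injI) (metis less(1) linorder_neqE_nat)
    show "inj (\<lambda>n. g n \<otimes> a n)" by (rule injI) (metis less(4) linorder_neqE_nat)
    show "a m \<noteq> g n \<otimes> a n" for m n by (metis less(2,3) eq linorder_neqE_nat)
  qed (fact car)
qed

text \<open>Pairs with even index fill the two promise slots. Odd \<open>a\<close> fill the slots
  \<open>4 * k + 1\<close>, and all remaining elements the slots \<open>4 * k\<close>.\<close>

lemma (in group) separating_enumeration:
  assumes inf: "infinite (carrier G)" and cnt: "countable (carrier G)"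
  shows "\<exists>\<pi> :: nat \<Rightarrow> 'a. bij_betw \<pi> UNIV (carrier G) \<and>
    (\<forall>g \<in> carrier G - {\<one>}. \<exists>j k. \<pi> (4 * k + 3) = g \<otimes> \<pi> (4 * j + 2))"
proof -
  define e where "e = from_nat_into (carrier G - {\<one>})"
  have ne: "carrier G - {\<one>} \<noteq> {}" using inf by (metis finite.simps finite_Diff2)
  have e: "e n \<in> carrier G" "e n \<noteq> \<one>" for n
    using from_nat_into[OF ne, of n] by (auto simp: e_def)
  \<comment> \<open>\<open>n div 2\<close> uses every nontrivial element at an even and at an odd
    index: the even pair separates, the odd pair leaves elements for the free slots.\<close>
  obtain a where a: "\<And>n. a n \<in> carrier G" "inj a" "inj (\<lambda>n. e (n div 2) \<otimes> a n)"
    "\<And>m n. a m \<noteq> e (n div 2) \<otimes> a n"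
    by (rule disjoint_translates[OF inf, where g = "\<lambda>n. e (n div 2)"]) (use e in auto)
  define b where "b = (\<lambda>n. e (n div 2) \<otimes> a n)"
  have b: "b n \<in> carrier G" for n using a(1) e by (simp add: b_def)
  have injb: "inj b" and ab: "a m \<noteq> b n" for m n using a by (auto simp: b_def)
  define F where "F = carrier G - (range a \<union> b ` {n. even n})"
  \<comment> \<open>The odd \<open>b\<close> make the remainder \<open>F\<close> infinite, so it can
    be enumerated without repetition along all of \<open>nat\<close>.\<close>
  have "b (2 * k + 1) \<in> F" for k
    using b ab injb unfolding F_def by (auto simp: inj_eq) (metis ab)+
  then have "range (\<lambda>k. b (2 * k + 1)) \<subseteq> F" by blast
  moreover have "inj (\<lambda>k. b (2 * k + 1))" by (rule injI) (simp add: inj_eq[OF injb])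
  ultimately have "infinite F" using range_inj_infinite finite_subset by blast
  moreover have "countable F" using cnt by (simp add: F_def)
  ultimately have F: "bij_betw (from_nat_into F) UNIV F" by (simp add: bij_betw_from_nat_into)
  define \<pi> where "\<pi> = (\<lambda>n. if n mod 4 = 0 then from_nat_into F (n div 4)
     else if n mod 4 = 1 then a (2 * (n div 4) + 1)
     else if n mod 4 = 2 then a (2 * (n div 4)) else b (2 * (n div 4)))"
  have \<pi>: "\<pi> (4 * k) = from_nat_into F k" "\<pi> (4 * k + 1) = a (2 * k + 1)"
    "\<pi> (4 * k + 2) = a (2 * k)" "\<pi> (4 * k + 3) = b (2 * k)" for k
  proof -
    have "(4 * k + 1) mod 4 = 1" "(4 * k + 1) div 4 = k" "(4 * k + 2) mod 4 = 2"
      "(4 * k + 2) div 4 = k" "(4 * k + 3) mod 4 = 3" "(4 * k + 3) div 4 = k"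
      by presburger+
    then show "\<pi> (4 * k) = from_nat_into F k" "\<pi> (4 * k + 1) = a (2 * k + 1)"
      "\<pi> (4 * k + 2) = a (2 * k)" "\<pi> (4 * k + 3) = b (2 * k)"
      by (simp_all only: \<pi>_def) simp_all
  qed
  have split4: "\<exists>k. n = 4 * k \<or> n = 4 * k + 1 \<or> n = 4 * k + 2 \<or> n = 4 * k + 3" for n :: nat
    by presburger
  have FF: "from_nat_into F k \<in> F" for k using F by (auto simp: bij_betw_def)
  have FF': "from_nat_into F k \<noteq> a m" "from_nat_into F k \<noteq> b (2 * m)" for k m
    using FF[of k] by (auto simp: F_def)
  have Finj: "from_nat_into F k = from_nat_into F k' \<longleftrightarrow> k = k'" for k k'
    using F by (auto simp: bij_betw_def inj_eq)
  have "inj \<pi>"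
  proof (rule injI)
    fix m n assume eq: "\<pi> m = \<pi> n"
    have odd: "2 * k + 1 \<noteq> 2 * k'" for k k' :: nat by presburger
    from split4[of m] split4[of n] eq show "m = n"
      by (elim exE disjE) (auto simp only: \<pi> Finj FF' FF'[symmetric] ab ab[symmetric]
          inj_eq[OF a(2)] inj_eq[OF injb] odd odd[symmetric])
  qed
  moreover have "range \<pi> = carrier G"
  proof (intro equalityI subsetI)
    fix x assume "x \<in> range \<pi>"
    then obtain n where n: "x = \<pi> n" by blast
    obtain k where "n = 4 * k \<or> n = 4 * k + 1 \<or> n = 4 * k + 2 \<or> n = 4 * k + 3"
      using split4 by blast
    then show "x \<in> carrier G" using n a(1) b FF[of k] by (auto simp only: \<pi> F_def)
  next
    fix x assume "x \<in> carrier G"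
    then consider "x \<in> F" | n where "x = a n" | n where "x = b n" "even n"
      unfolding F_def by blast
    then show "x \<in> range \<pi>"
    proof cases
      case 1
      then obtain k where "x = from_nat_into F k" using F by (auto simp: bij_betw_def)
      then show ?thesis using \<pi>(1) by (metis rangeI)
    next
      case (2 n)
      then show ?thesis using \<pi>(2,3) by (cases "even n") (metis evenE oddE rangeI)+
    next
      case (3 n)
      then show ?thesis using \<pi>(4) by (metis evenE rangeI)
    qed
  qed
  ultimately have bij: "bij_betw \<pi> UNIV (carrier G)" by (simp add: bij_betw_def)
  have "\<exists>j k. \<pi> (4 * k + 3) = g \<otimes> \<pi> (4 * j + 2)" if g: "g \<in> carrier G" "g \<noteq> \<one>" for g
  proof -
    obtain n where n: "e n = g"
      using g cnt unfolding e_def by (metis DiffI countable_Diff empty_iff from_nat_into_surj insert_iff)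
    have "\<pi> (4 * n + 3) = g \<otimes> \<pi> (4 * n + 2)" by (simp only: \<pi>) (simp add: b_def n)
    then show ?thesis by blast
  qed
  then show ?thesis using bij by (intro exI[of _ \<pi>]) simp
qed

section \<open>Transfer to the shift action\<close>

lemma homeomorphic_maps_enum:
  assumes \<pi>: "bij_betw \<pi> UNIV (carrier G)"
  shows "homeomorphic_maps (power_space S (carrier G)) (power_space S UNIV)
    (\<lambda>x. x \<circ> \<pi>) (enum_map G \<pi>)"
  unfolding homeomorphic_maps_def
proof (intro conjI ballI)
  have car: "\<pi> n \<in> carrier G" and inv\<pi>: "inv_into UNIV \<pi> (\<pi> n) = n" for n
    using \<pi> by (auto simp: bij_betw_def)
  have \<pi>inv: "\<pi> (inv_into UNIV \<pi> h) = h" if "h \<in> carrier G" for h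
    using \<pi> that by (auto simp: bij_betw_def f_inv_into_f)
  show "continuous_map (power_space S (carrier G)) (power_space S UNIV) (\<lambda>x. x \<circ> \<pi>)"
    by (rule continuous_map_power_space_reindex) (rule car)
  have "continuous_map (power_space S UNIV) (discrete_topology S) (\<lambda>x. enum_map G \<pi> x h)"
    if "h \<in> carrier G" for h
    using that continuous_map_power_space_coordinate[of _ UNIV S] by (simp add: enum_map_def)
  then show "continuous_map (power_space S UNIV) (power_space S (carrier G)) (enum_map G \<pi>)"
    unfolding power_space_def[of S "carrier G"] continuous_map_componentwise
    by (auto simp: enum_map_def)
  show "enum_map G \<pi> (x \<circ> \<pi>) = x" if "x \<in> topspace (power_space S (carrier G))" for x
    using that \<pi>inv by (intro ext) (auto simp: enum_map_def power_space_def PiE_def extensional_def)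
  show "enum_map G \<pi> y \<circ> \<pi> = y" for y
    using car inv\<pi> by (auto simp: enum_map_def)
qed

lemma (in group) invariant_determinacy_imp_determinacy:
  assumes inf: "infinite (carrier G)" and cnt: "countable (carrier G)"
    and S: "0 \<in> S" "1 \<in> S"
    and \<Gamma>: "reasonable \<Gamma>" and det\<Gamma>: "invariant_determinacy \<Gamma> G S"
  shows "pointclass_determinacy \<Gamma> S"
proof -
  obtain \<pi> :: "nat \<Rightarrow> 'a" where \<pi>: "bij_betw \<pi> UNIV (carrier G)"
    and sep: "\<forall>g \<in> carrier G - {\<one>}. \<exists>j k. \<pi> (4 * k + 3) = g \<otimes> \<pi> (4 * j + 2)"
    using separating_enumeration[OF inf cnt] by (elim exE conjE)
  have car: "\<pi> n \<in> carrier G" and inv\<pi>: "inv_into UNIV \<pi> (\<pi> n) = n" for n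
    using \<pi> by (auto simp: bij_betw_def)
  have \<pi>inv: "\<pi> (inv_into UNIV \<pi> h) = h" if "h \<in> carrier G" for h
    using \<pi> that by (auto simp: bij_betw_def f_inv_into_f)
  \<comment> \<open>Chosen so that the shift by \<open>g\<close> becomes composition with
    \<open>q g\<close> after reindexing by \<open>\<pi>\<close>.\<close>
  define q where "q = (\<lambda>g n. inv_into UNIV \<pi> (inv g \<otimes> \<pi> n))"
  have q: "q g n = inv_into UNIV \<pi> (inv g \<otimes> \<pi> n)" for g n by (simp add: q_def)
  have \<pi>q: "\<pi> (q g n) = inv g \<otimes> \<pi> n" if "g \<in> carrier G" for g n
    unfolding q_def using that car by (intro \<pi>inv) auto
  have qI: "q g n = m" if "\<pi> n = g \<otimes> \<pi> m" "g \<in> carrier G" for g m n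
    using that car inv\<pi> by (simp add: q_def m_assoc[symmetric])
  have q_one: "q \<one> = id"
    by (rule ext, rule trans[OF qI]) (use car in auto)
  \<comment> \<open>The order is reversed because composition on the right turns the left shift
    action into a right action.\<close>
  have q_mult: "q g \<circ> q h = q (h \<otimes> g)" if "g \<in> carrier G" "h \<in> carrier G" for g h
  proof
    fix n
    show "(q g \<circ> q h) n = q (h \<otimes> g) n"
      using that car by (simp add: q[of g] q[of "h \<otimes> g"] \<pi>q inv_mult_group m_assoc)
  qed
  interpret separating_permutations "q ` carrier G" S
  proof
    show "countable (q ` carrier G)" using cnt by blast
    show "id \<in> q ` carrier G" using imageI[OF one_closed, of q] q_one by simp
    show "p \<circ> p' \<in> q ` carrier G" if p: "p \<in> q ` carrier G" "p' \<in> q ` carrier G" for p p'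
    proof -
      obtain g h where gh: "g \<in> carrier G" "p = q g" "h \<in> carrier G" "p' = q h"
        using p by blast
      then show ?thesis using imageI[OF m_closed, of h g q] q_mult by simp
    qed
    show "\<exists>p'\<in>q ` carrier G. p \<circ> p' = id" if p: "p \<in> q ` carrier G" for p
    proof -
      obtain g where g: "g \<in> carrier G" "p = q g" using p by blast
      then have "p \<circ> q (inv g) = id" using q_mult[of g "inv g"] q_one by simp
      then show ?thesis using imageI[OF inv_closed[OF g(1)], of q] by (rule bexI)
    qed
    show "\<exists>j k. p (4 * k + 3) = 4 * j + 2" if p: "p \<in> q ` carrier G" "p \<noteq> id" for p
    proof -
      obtain g where g: "g \<in> carrier G" "p = q g" using p(1) by blast
      then have "g \<noteq> \<one>" using p(2) q_one by blast
      then obtain j k where "\<pi> (4 * k + 3) = g \<otimes> \<pi> (4 * j + 2)" using sep g(1) by blast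
      then show ?thesis using qI g by blast
    qed
    show "0 \<in> S" "1 \<in> S" by (fact S)+
  qed
  let ?X = "power_space S (carrier G)"
  have pc: "is_pointclass \<Gamma>" using \<Gamma> unfolding reasonable_def by blast
  have hom: "homeomorphic_maps ?X N (\<lambda>x. x \<circ> \<pi>) (enum_map G \<pi>)"
    by (rule homeomorphic_maps_enum[OF \<pi>])
  have enum: "enum_map G \<pi> y \<in> topspace ?X" "enum_map G \<pi> y \<circ> \<pi> = y" if "y \<in> topspace N" for y
    using hom that unfolding homeomorphic_maps_def continuous_map_def by auto
  show ?thesis
    unfolding pointclass_determinacy_def
  proof (intro allI impI)
    fix A assume "A \<in> \<Gamma> N"
    then obtain B where B: "B \<in> \<Gamma> N" "\<And>y p. y \<in> B \<Longrightarrow> p \<in> q ` carrier G \<Longrightarrow> y \<circ> p \<in> B"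
      and det: "determined S B \<Longrightarrow> determined S A"
      by (rule invariant_coding[OF \<Gamma>]) blast
    have BN: "B \<subseteq> topspace N" using pc B(1) unfolding is_pointclass_def by blast
    define A' where "A' = {x \<in> topspace ?X. x \<circ> \<pi> \<in> B}"
    have "(\<lambda>x. x \<circ> \<pi>) ` A' = B"
    proof (intro equalityI subsetI)
      fix y assume "y \<in> B"
      then show "y \<in> (\<lambda>x. x \<circ> \<pi>) ` A'"
        using BN enum[of y] unfolding A'_def by (intro image_eqI[of _ _ "enum_map G \<pi> y"]) auto
    qed (auto simp: A'_def)
    then have "in_pointclass \<Gamma> ?X A'"
      using in_pointclass_iff[OF pc homeomorphic_maps_imp_map[OF hom], of A'] B(1)
      unfolding A'_def by simp
    moreover have "invariant_under (shift_orbit_rel G S) A'"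
      unfolding invariant_under_def
    proof (intro allI impI)
      fix x y assume "(x, y) \<in> shift_orbit_rel G S" and x: "x \<in> A'"
      then obtain g where g: "g \<in> carrier G" "y = shift G g x"
        unfolding shift_orbit_rel_def by blast
      have "y \<circ> \<pi> = (x \<circ> \<pi>) \<circ> q g"
        using g car by (auto simp: shift_def \<pi>q)
      then have "y \<circ> \<pi> \<in> B" using x g(1) B(2) unfolding A'_def by simp
      moreover have "y \<in> topspace ?X"
        using x g by (auto simp: A'_def power_space_def shift_def PiE_def Pi_def)
      ultimately show "y \<in> A'" by (simp add: A'_def)
    qed
    ultimately have "determined S {x \<in> topspace N. enum_map G \<pi> x \<in> A'}"
      using det\<Gamma> \<pi> unfolding invariant_determinacy_def by blast
    moreover have "{x \<in> topspace N. enum_map G \<pi> x \<in> A'} = B"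
      using BN enum unfolding A'_def by auto
    ultimately show "determined S A" using det by simp
  qed
qed

theorem theorem2p6:
  fixes G :: "('g, 'b) monoid_scheme" and S :: "nat set" and \<Gamma> :: pointclass
  assumes "group G" and "countable (carrier G)"
    and "\<exists>H. subgroup H G \<and> infinite H \<and> weakly_amenable (G\<lparr>carrier := H\<rparr>)"
    and "S = {0, 1} \<or> S = UNIV"
    and "reasonable \<Gamma>"
    and "invariant_determinacy \<Gamma> G S"
  shows "pointclass_determinacy \<Gamma> S"
proof -
  \<comment> \<open>The infinite subgroup makes \<open>G\<close> infinite, as the greedy enumeration
    requires.\<close>
  have "infinite (carrier G)"
    using assms(3) subgroup.subset finite_subset by blast
  then show ?thesis
    using group.invariant_determinacy_imp_determinacy[OF assms(1) _ assms(2) _ _ assms(5,6)]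
      assms(4) by auto
qed

end
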